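(* In the data markets game with joint externality, under the transaction cost $\mathcal{T}_i(S)=\alpha\sum_{j\ne i}\big(\hat{E}_{ji}(\gamma_i,\gamma_j)-\hat{E}_{ij}(\gamma_i,\gamma_j)\big)$ with $\alpha\in[0,1]$, there always exists an $\varepsilon$-pure Nash equilibrium with $$\varepsilon=\max_i\Big\{2|\alpha-0.5|\sum_{j\ne i}\max_{\gamma_i,\gamma_j}\big|\hat{e}_{ji}(\gamma_i,\gamma_j)-\hat{e}_{ij}(\gamma_i,\gamma_j)\big|+\sum_{j\ne i}\max_{\gamma_i,\gamma_j}\big|b_{ij}(\gamma_i,\gamma_j)-b_{ji}(\gamma_i,\gamma_j)\big|\Big\}.$$
   Context: Data markets game with joint externality: there are $n$ buyers and $k$ sellers. Each buyer $i$ simultaneously chooses a seller set $\gamma_i$ (a subset of the sellers, possibly empty); $S=(\gamma_1,\dots,\gamma_n)$. Buyer $i$'s expected net gain is $g_i(\gamma)\in[-1,1]$, with $g_i(\emptyset)=0$. The externality that buyer $i$ suffers from buyer $j\ne i$ is random with mean $e_{ij}(\gamma_i,\gamma_j)\ge0$, depending on both orders. Notational convention: in both $e_{ij}(\gamma_i,\gamma_j)$ and $e_{ji}(\gamma_i,\gamma_j)$, $\gamma_i$ is what $i$ buys and $\gamma_j$ is what $j$ buys (and similarly for $\hat{e}$, $b$). Total caused externality is normalized: $\sum_{j\ne i}e_{ji}(\gamma_i,\gamma_j)\in[0,1]$ for every $i$ and every profile. The platform has random predicted externalities $\hat{E}_{ij}(\gamma_i,\gamma_j)$ with means $\hat{e}_{ij}(\gamma_i,\gamma_j)$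 and bias $b_{ij}(\gamma_i,\gamma_j)=e_{ij}(\gamma_i,\gamma_j)-\hat{e}_{ij}(\gamma_i,\gamma_j)$. Buyer $i$'s expected utility is $$u_i(S)=g_i(\gamma_i)-\sum_{j\ne i}e_{ij}(\gamma_i,\gamma_j)-\alpha\sum_{j\ne i}\big(\hat{e}_{ji}(\gamma_i,\gamma_j)-\hat{e}_{ij}(\gamma_i,\gamma_j)\big).$$ A profile $S^q=(\gamma_1^q,\dots,\gamma_n^q)$ is an $\varepsilon$-pure Nash equilibrium if no buyer $i$ can increase her expected utility by more than $\varepsilon$ by unilaterally deviating from $\gamma_i^q$. *)

theory Defs
  imports "HOL-Probability.Probability"
begin

text \<open>
  Buyers are \<open>{..<n}\<close>, sellers are \<open>{..<k}\<close>. A pairwise quantity \<open>F i j A B\<close> (realised or predicted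
  externality, mean, bias) is what buyer \<open>i\<close> suffers from buyer \<open>j\<close> when \<open>i\<close> buys \<open>A\<close> and \<open>j\<close> buys
  \<open>B\<close>: the seller sets come in the order of the buyer indices. Hence the value written
  $F_{ij}(\gamma_i,\gamma_j)$ is \<open>F i j (S i) (S j)\<close>, whereas $F_{ji}(\gamma_i,\gamma_j)$, in which
  $\gamma_i$ is still what \<open>i\<close> buys, is \<open>F j i (S j) (S i)\<close>.
\<close>

type_synonym profile = "nat \<Rightarrow> nat set"

type_synonym 'r gain = "nat \<Rightarrow> nat set \<Rightarrow> 'r"

type_synonym 'r pairwise = "nat \<Rightarrow> nat \<Rightarrow> nat set \<Rightarrow> nat set \<Rightarrow> 'r"

definition profiles :: "nat \<Rightarrow> nat \<Rightarrow> profile set" where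
  "profiles n k = {..<n} \<rightarrow>\<^sub>E Pow {..<k}"

definition mean_gain :: "'w measure \<Rightarrow> ('w \<Rightarrow> real) gain \<Rightarrow> real gain" where
  "mean_gain M G i A = (\<integral>w. G i A w \<partial>M)"

definition mean_ext :: "'w measure \<Rightarrow> ('w \<Rightarrow> real) pairwise \<Rightarrow> real pairwise" where
  "mean_ext M F i j A B = (\<integral>w. F i j A B w \<partial>M)"

definition bias ::
  "'w measure \<Rightarrow> ('w \<Rightarrow> real) pairwise \<Rightarrow> ('w \<Rightarrow> real) pairwise \<Rightarrow> real pairwise" where
  "bias M E Ehat i j A B = mean_ext M E i j A B - mean_ext M Ehat i j A B"

text \<open>
  \<open>G\<close>, \<open>E\<close> and \<open>Ehat\<close> are the random net gains, externalities and predicted externalities.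
  All sign and normalisation conditions concern their means, and no joint distribution or
  independence is prescribed.
\<close>

locale data_market = prob_space M
  for M :: "'w measure" +
  fixes n k :: nat
    and G :: "('w \<Rightarrow> real) gain"
    and E Ehat :: "('w \<Rightarrow> real) pairwise"
  assumes integrable_gain:
      "\<lbrakk>i < n; A \<subseteq> {..<k}\<rbrakk> \<Longrightarrow> integrable M (G i A)"
    and integrable_ext:
      "\<lbrakk>i < n; j < n; i \<noteq> j; A \<subseteq> {..<k}; B \<subseteq> {..<k}\<rbrakk> \<Longrightarrow> integrable M (E i j A B)"
    and integrable_pred:
      "\<lbrakk>i < n; j < n; i \<noteq> j; A \<subseteq> {..<k}; B \<subseteq> {..<k}\<rbrakk> \<Longrightarrow> integrable M (Ehat i j A B)"
    and gain_bounds: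
      "\<lbrakk>i < n; A \<subseteq> {..<k}\<rbrakk> \<Longrightarrow> mean_gain M G i A \<in> {-1..1}"
    and gain_empty:
      "i < n \<Longrightarrow> mean_gain M G i {} = 0"
    and ext_nonneg:
      "\<lbrakk>i < n; j < n; i \<noteq> j; A \<subseteq> {..<k}; B \<subseteq> {..<k}\<rbrakk> \<Longrightarrow> mean_ext M E i j A B \<ge> 0"
    and ext_normalized:
      "\<lbrakk>i < n; S \<in> profiles n k\<rbrakk> \<Longrightarrow>
        (\<Sum>j\<in>{..<n} - {i}. mean_ext M E j i (S j) (S i)) \<in> {0..1}"

definition transaction_cost ::
  "nat \<Rightarrow> real \<Rightarrow> ('w \<Rightarrow> real) pairwise \<Rightarrow> nat \<Rightarrow> profile \<Rightarrow> 'w \<Rightarrow> real" where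
  "transaction_cost n \<alpha> Ehat i S w =
     \<alpha> * (\<Sum>j\<in>{..<n} - {i}. Ehat j i (S j) (S i) w - Ehat i j (S i) (S j) w)"

definition realized_utility ::
  "nat \<Rightarrow> ('w \<Rightarrow> real) gain \<Rightarrow> ('w \<Rightarrow> real) pairwise \<Rightarrow> (nat \<Rightarrow> profile \<Rightarrow> 'w \<Rightarrow> real) \<Rightarrow>
    nat \<Rightarrow> profile \<Rightarrow> 'w \<Rightarrow> real" where
  "realized_utility n G E T i S w =
     G i (S i) w - (\<Sum>j\<in>{..<n} - {i}. E i j (S i) (S j) w) - T i S w"

definition expected_utility ::
  "'w measure \<Rightarrow> nat \<Rightarrow> ('w \<Rightarrow> real) gain \<Rightarrow> ('w \<Rightarrow> real) pairwise \<Rightarrow>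
    (nat \<Rightarrow> profile \<Rightarrow> 'w \<Rightarrow> real) \<Rightarrow> nat \<Rightarrow> profile \<Rightarrow> real" where
  "expected_utility M n G E T i S = (\<integral>w. realized_utility n G E T i S w \<partial>M)"

lemma (in data_market) expected_utility_eq:
  assumes i: "i < n" and S: "S \<in> profiles n k"
  shows "expected_utility M n G E (transaction_cost n \<alpha> Ehat) i S =
    mean_gain M G i (S i)
      - (\<Sum>j\<in>{..<n} - {i}. mean_ext M E i j (S i) (S j))
      - \<alpha> * (\<Sum>j\<in>{..<n} - {i}.
          mean_ext M Ehat j i (S j) (S i) - mean_ext M Ehat i j (S i) (S j))"
proof -
  have sub: "S j \<subseteq> {..<k}" if "j < n" for j
    using S that by (auto simp: profiles_def PiE_def Pi_def)
  have G: "integrable M (G i (S i))"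
    using i sub by (intro integrable_gain) auto
  have E: "integrable M (E i j (S i) (S j))" if "j \<in> {..<n} - {i}" for j
    using i that sub by (intro integrable_ext) auto
  have P: "integrable M (Ehat j i (S j) (S i))" "integrable M (Ehat i j (S i) (S j))"
    if "j \<in> {..<n} - {i}" for j
    using i that sub by (auto intro!: integrable_pred)
  have intE: "integrable M (\<lambda>w. \<Sum>j\<in>{..<n} - {i}. E i j (S i) (S j) w)"
    using E by (intro Bochner_Integration.integrable_sum) auto
  have intP: "integrable M (\<lambda>w. \<Sum>j\<in>{..<n} - {i}. Ehat j i (S j) (S i) w - Ehat i j (S i) (S j) w)"
    using P by (intro Bochner_Integration.integrable_sum Bochner_Integration.integrable_diff) auto
  have sumE: "(\<integral>w. (\<Sum>j\<in>{..<n} - {i}. E i j (S i) (S j) w) \<partial>M) =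
      (\<Sum>j\<in>{..<n} - {i}. \<integral>w. E i j (S i) (S j) w \<partial>M)"
    using E by (intro Bochner_Integration.integral_sum) auto
  have "(\<integral>w. (\<Sum>j\<in>{..<n} - {i}. Ehat j i (S j) (S i) w - Ehat i j (S i) (S j) w) \<partial>M) =
      (\<Sum>j\<in>{..<n} - {i}. \<integral>w. Ehat j i (S j) (S i) w - Ehat i j (S i) (S j) w \<partial>M)"
    using P by (intro Bochner_Integration.integral_sum Bochner_Integration.integrable_diff) auto
  also have "\<dots> = (\<Sum>j\<in>{..<n} - {i}.
      (\<integral>w. Ehat j i (S j) (S i) w \<partial>M) - (\<integral>w. Ehat i j (S i) (S j) w \<partial>M))"
    using P by (intro sum.cong Bochner_Integration.integral_diff) auto
  finally show ?thesis
    unfolding expected_utility_def realized_utility_def transaction_cost_def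
      mean_gain_def mean_ext_def
    using G intE intP sumE by simp
qed

definition eps_pure_nash ::
  "nat \<Rightarrow> nat \<Rightarrow> (nat \<Rightarrow> profile \<Rightarrow> real) \<Rightarrow> real \<Rightarrow> profile \<Rightarrow> bool" where
  "eps_pure_nash n k u \<epsilon> S \<longleftrightarrow>
     S \<in> profiles n k \<and>
     (\<forall>i<n. \<forall>A\<in>Pow {..<k}. u i (S(i := A)) - u i S \<le> \<epsilon>)"

end

theory Submission
  imports Defs
begin

text \<open>
  Split \<open>e\<^sub>i\<^sub>j\<close> into its symmetric part \<open>(e\<^sub>i\<^sub>j + e\<^sub>j\<^sub>i) / 2\<close> and its antisymmetric part. Gains together with a
  symmetric pairwise externality form an exact potential game, with potential the total gain minus
  the symmetric externality summed over unordered pairs. What remains of \<open>u\<^sub>i\<close> is the sum over \<open>j\<close> of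
  \<open>(1/2 - \<alpha>) (\<^emph>\<open>pred\<close>\<^sub>j\<^sub>i - \<^emph>\<open>pred\<close>\<^sub>i\<^sub>j) + (b\<^sub>j\<^sub>i - b\<^sub>i\<^sub>j) / 2\<close>, where \<^emph>\<open>pred\<close> is the mean predicted externality; a
  deviation changes it by at most twice its maximal absolute value, which is the stated
  \<open>\<epsilon>\<close>. Hence any maximiser of the potential is an equilibrium.
\<close>

text \<open>Index \<open>i\<close> occurs in its own row and once in every other row. By symmetry
  the column entries add up to the row sum, hence the factor 2; the last double sum never mentions
  \<open>i\<close>.\<close>

lemma sum_off_diagonal_split:
  fixes W :: "'a \<Rightarrow> 'a \<Rightarrow> real"
  assumes "finite I" "i \<in> I" and sym: "\<And>p q. W p q = W q p"
  shows "(\<Sum>p\<in>I. \<Sum>q\<in>I - {p}. W p q) =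
    2 * (\<Sum>q\<in>I - {i}. W i q) + (\<Sum>p\<in>I - {i}. \<Sum>q\<in>I - {p} - {i}. W p q)"
proof -
  have "(\<Sum>q\<in>I - {p}. W p q) = W i p + (\<Sum>q\<in>I - {p} - {i}. W p q)" if "p \<in> I - {i}" for p
    using that assms sym[of p i] by (subst sum.remove[of _ i]) auto
  then have "(\<Sum>p\<in>I - {i}. \<Sum>q\<in>I - {p}. W p q) =
      (\<Sum>p\<in>I - {i}. W i p) + (\<Sum>p\<in>I - {i}. \<Sum>q\<in>I - {p} - {i}. W p q)"
    by (simp add: sum.distrib)
  then show ?thesis
    using assms(1,2) by (subst sum.remove[of _ i]) auto
qed

text \<open>The ordered double sum meets every unordered pair twice; for symmetric \<open>s\<close>
  the division by 2 corrects this.\<close>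

definition sym_potential :: "nat \<Rightarrow> real gain \<Rightarrow> real pairwise \<Rightarrow> profile \<Rightarrow> real" where
  "sym_potential n g s S =
    (\<Sum>i<n. g i (S i)) - (\<Sum>i<n. \<Sum>j\<in>{..<n} - {i}. s i j (S i) (S j)) / 2"

text \<open>The halving cancels the factor 2 of the split, so the potential is the payoff of buyer
  \<open>i\<close> in the symmetric game plus a rest \<open>R\<close> that does not read coordinate
  \<open>i\<close> and cancels in the difference.\<close>

lemma sym_potential_deviation:
  assumes i: "i < n" and sym: "\<And>p q A B. s p q A B = s q p B A"
  shows "sym_potential n g s (S(i := A)) - sym_potential n g s S =
    (g i A - (\<Sum>j\<in>{..<n} - {i}. s i j A (S j))) -
    (g i (S i) - (\<Sum>j\<in>{..<n} - {i}. s i j (S i) (S j)))"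
proof -
  let ?I = "{..<n}"
  define R where "R T = (\<Sum>p\<in>?I - {i}. g p (T p)) -
    (\<Sum>p\<in>?I - {i}. \<Sum>q\<in>?I - {p} - {i}. s p q (T p) (T q)) / 2" for T :: profile
  have split: "sym_potential n g s T =
      g i (T i) - (\<Sum>j\<in>?I - {i}. s i j (T i) (T j)) + R T" for T
    using i sum.remove[of ?I i "\<lambda>p. g p (T p)"]
      sum_off_diagonal_split[of ?I i "\<lambda>p q. s p q (T p) (T q)", OF _ _ sym]
    by (simp add: sym_potential_def R_def field_simps)
  have "R (S(i := A)) = R S"
    unfolding R_def by (intro arg_cong2[of _ _ _ _ "(-)"] arg_cong2[of _ _ _ _ "(/)"] sum.cong) auto
  moreover have "(\<Sum>j\<in>?I - {i}. s i j A ((S(i := A)) j)) = (\<Sum>j\<in>?I - {i}. s i j A (S j))"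
    by (intro sum.cong) auto
  ultimately show ?thesis
    by (simp add: split)
qed

lemma profiles_fun_upd:
  "\<lbrakk>S \<in> profiles n k; i < n; A \<subseteq> {..<k}\<rbrakk> \<Longrightarrow> S(i := A) \<in> profiles n k"
  unfolding profiles_def by (auto simp: PiE_def Pi_def extensional_def)

text \<open>There are finitely many profiles and at least one, so \<Phi> attains a maximum. There no
  deviation raises \<Phi>, and only the slack \<epsilon> remains.\<close>

lemma eps_pure_nash_if_near_potential:
  assumes "\<And>i S A. \<lbrakk>i < n; S \<in> profiles n k; A \<subseteq> {..<k}\<rbrakk> \<Longrightarrow>
    u i (S(i := A)) - u i S \<le> \<Phi> (S(i := A)) - \<Phi> S + (\<epsilon> :: real)"
  shows "\<exists>S. eps_pure_nash n k u \<epsilon> S"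
proof -
  have fin: "finite (profiles n k)" and ne: "profiles n k \<noteq> {}"
    unfolding profiles_def by (auto intro!: finite_PiE simp: PiE_eq_empty_iff)
  obtain S where S: "S \<in> profiles n k" "\<And>T. T \<in> profiles n k \<Longrightarrow> \<Phi> T \<le> (\<Phi> S :: real)"
  proof -
    have "Max (\<Phi> ` profiles n k) \<in> \<Phi> ` profiles n k"
      using fin ne by simp
    then show thesis
      using that fin by (metis Max_ge finite_imageI image_iff)
  qed
  have "u i (S(i := A)) - u i S \<le> \<epsilon>" if "i < n" "A \<subseteq> {..<k}" for i A
    using assms[OF that(1) S(1) that(2)] S(2)[OF profiles_fun_upd[OF S(1) that]] by simp
  with S(1) show ?thesis
    unfolding eps_pure_nash_def by blast
qed

lemma abs_le_Max_pair:
  fixes f :: "'a \<Rightarrow> 'b \<Rightarrow> real"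
  assumes "finite X" "finite Y" "A \<in> X" "B \<in> Y"
  shows "\<bar>f A B\<bar> \<le> (MAX (A, B)\<in>X \<times> Y. \<bar>f A B\<bar>)"
  using assms by (intro Max_ge) (auto intro!: image_eqI[of _ _ "(A, B)"])

theorem theorem6:
  fixes M :: "'w measure" and n k :: nat and \<alpha> :: real
    and G :: "('w \<Rightarrow> real) gain"
    and E Ehat :: "('w \<Rightarrow> real) pairwise"
  assumes "data_market M n k G E Ehat"
    and "n \<ge> 1"
    and "\<alpha> \<in> {0..1}"
  shows "\<exists>S. eps_pure_nash n k
    (expected_utility M n G E (transaction_cost n \<alpha> Ehat))
    (MAX i\<in>{..<n}.
      2 * \<bar>\<alpha> - 1/2\<bar> *
        (\<Sum>j\<in>{..<n} - {i}. MAX (A, B)\<in>Pow {..<k} \<times> Pow {..<k}.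
          \<bar>mean_ext M Ehat j i B A - mean_ext M Ehat i j A B\<bar>)
      + (\<Sum>j\<in>{..<n} - {i}. MAX (A, B)\<in>Pow {..<k} \<times> Pow {..<k}.
          \<bar>bias M E Ehat i j A B - bias M E Ehat j i B A\<bar>))
    S"
proof (rule eps_pure_nash_if_near_potential)
  interpret data_market M n k G E Ehat by fact
  let ?I = "{..<n}" and ?K = "Pow {..<k}"
  let ?u = "expected_utility M n G E (transaction_cost n \<alpha> Ehat)"
  define s where "s i j A B = (mean_ext M E i j A B + mean_ext M E j i B A) / 2" for i j A B
  define d where "d i j A B = mean_ext M Ehat j i B A - mean_ext M Ehat i j A B" for i j A B
  define c where "c i j A B = bias M E Ehat i j A B - bias M E Ehat j i B A" for i j A B
  \<comment> \<open>The mean externality is prediction plus bias, so its antisymmetric part is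
    \<open>(c - d) / 2\<close>. Subtracting that and the payment term \<open>\<alpha> * d\<close>
    leaves \<open>r\<close>.\<close>
  define r where "r i j A B = (1/2 - \<alpha>) * d i j A B - c i j A B / 2" for i j A B
  define D where "D i j = (MAX (A, B)\<in>?K \<times> ?K. \<bar>d i j A B\<bar>)" for i j
  define C where "C i j = (MAX (A, B)\<in>?K \<times> ?K. \<bar>c i j A B\<bar>)" for i j
  define \<epsilon> where "\<epsilon> i = 2 * \<bar>\<alpha> - 1/2\<bar> * (\<Sum>j\<in>?I - {i}. D i j) + (\<Sum>j\<in>?I - {i}. C i j)" for i
  have sym: "s p q A B = s q p B A" for p q A B
    by (simp add: s_def)
  have u: "?u i S = mean_gain M G i (S i) - (\<Sum>j\<in>?I - {i}. s i j (S i) (S j))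
      + (\<Sum>j\<in>?I - {i}. r i j (S i) (S j))" if "i < n" "S \<in> profiles n k" for i S
    by (simp add: expected_utility_eq[OF that] sum_distrib_left s_def r_def d_def c_def bias_def
        sum_subtractf sum.distrib algebra_simps add_divide_distrib diff_divide_distrib
        flip: sum_divide_distrib)
  have r: "\<bar>r i j A B\<bar> \<le> \<bar>\<alpha> - 1/2\<bar> * D i j + C i j / 2" if "A \<in> ?K" "B \<in> ?K" for i j A B
  proof -
    have "\<bar>r i j A B\<bar> \<le> \<bar>\<alpha> - 1/2\<bar> * \<bar>d i j A B\<bar> + \<bar>c i j A B\<bar> / 2"
      unfolding r_def by (rule order_trans[OF abs_triangle_ineq4]) (simp add: abs_mult abs_minus_commute)
    also have "\<dots> \<le> \<bar>\<alpha> - 1/2\<bar> * D i j + C i j / 2"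
      using abs_le_Max_pair[OF _ _ that, of "d i j"] abs_le_Max_pair[OF _ _ that, of "c i j"]
      unfolding D_def C_def by (intro add_mono mult_left_mono divide_right_mono) auto
    finally show ?thesis .
  qed
  fix i S A
  assume i: "i < n" and S: "S \<in> profiles n k" and A: "A \<subseteq> {..<k}"
  \<comment> \<open>This is the potential that the opening rule left open.\<close>
  let ?\<Phi> = "sym_potential n (mean_gain M G) s"
  let ?S' = "S(i := A)"
  have S': "?S' \<in> profiles n k"
    using profiles_fun_upd[OF S i A] .
  have K: "S j \<in> ?K" if "j < n" for j
    using S that unfolding profiles_def by (auto dest: PiE_mem)
  have upd: "(\<Sum>j\<in>?I - {i}. f j (?S' i) (?S' j)) = (\<Sum>j\<in>?I - {i}. f j A (S j))"
    for f :: "nat \<Rightarrow> nat set \<Rightarrow> nat set \<Rightarrow> real"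
    by (intro sum.cong) auto
  have du: "?u i ?S' - ?u i S = ?\<Phi> ?S' - ?\<Phi> S
      + (\<Sum>j\<in>?I - {i}. r i j A (S j) - r i j (S i) (S j))"
    unfolding u[OF i S] u[OF i S'] upd sym_potential_deviation[of i n s, OF i sym] sum_subtractf
    by simp
  \<comment> \<open>The bound on \<open>r\<close> is uniform in the seller sets, so it applies
    before and after the deviation. Adding the two doubles \<open>C i j / 2\<close> to
    \<open>C i j\<close> and yields the factor 2 in front of \<open>D i j\<close>.\<close>
  have "(\<Sum>j\<in>?I - {i}. r i j A (S j) - r i j (S i) (S j)) \<le>
      (\<Sum>j\<in>?I - {i}. 2 * (\<bar>\<alpha> - 1/2\<bar> * D i j) + C i j)"
  proof (rule sum_mono)
    fix j assume "j \<in> ?I - {i}"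
    then show "r i j A (S j) - r i j (S i) (S j) \<le> 2 * (\<bar>\<alpha> - 1/2\<bar> * D i j) + C i j"
      using r[of A "S j" i j] r[of "S i" "S j" i j] K i A by fastforce
  qed
  also have "\<dots> = \<epsilon> i"
    by (simp add: \<epsilon>_def sum.distrib sum_distrib_left mult.assoc)
  also have "\<dots> \<le> (MAX i\<in>?I. \<epsilon> i)"
    using i by (intro Max_ge) auto
  finally show "?u i ?S' - ?u i S \<le> ?\<Phi> ?S' - ?\<Phi> S + (MAX i\<in>?I.
      2 * \<bar>\<alpha> - 1/2\<bar> *
        (\<Sum>j\<in>?I - {i}. MAX (A, B)\<in>?K \<times> ?K.
          \<bar>mean_ext M Ehat j i B A - mean_ext M Ehat i j A B\<bar>)
      + (\<Sum>j\<in>?I - {i}. MAX (A, B)\<in>?K \<times> ?K.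
          \<bar>bias M E Ehat i j A B - bias M E Ehat j i B A\<bar>))"
    unfolding du by (simp add: \<epsilon>_def D_def C_def d_def c_def)
qed

end
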